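(* For any nonempty graph $G$ (i.e. with at least one edge), \[ \frac{1}{\kappa_f(G)} + \frac{1}{\chi_f(G)} = 1, \] where $\chi_f(G)$ is the fractional chromatic number of $G$.
   Context: A vertex cover of $G$ is a set $S$ of vertices such that $V(G)\setminus S$ is independent. $H_{VC}(G)$ is the hypergraph with vertex set $V(G)$ whose edges are all vertex covers of $G$. $\kappa_f(G)$ is the fractional matching number of $H_{VC}(G)$, i.e. the optimal value of $\max\sum_{S} y_S$ over vertex covers $S$, subject to $\sum_{S\ni v} y_S\le 1$ for all $v \in V(G)$ and $y\ge 0$. *)

theory Defs
  imports Complex_Main
begin

text \<open>A (hyper)graph is a pair of a vertex set and a set of edges, each edge being a set of
  vertices. A simple graph is the case in which all edges have exactly two elements.\<close>

type_synonym 'a hypergraph = "'a set \<times> 'a set set"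

abbreviation verts :: "'a hypergraph \<Rightarrow> 'a set" where
  "verts H \<equiv> fst H"

abbreviation edges :: "'a hypergraph \<Rightarrow> 'a set set" where
  "edges H \<equiv> snd H"

definition finite_simple_graph :: "'a hypergraph \<Rightarrow> bool" where
  "finite_simple_graph G \<longleftrightarrow>
     finite (verts G) \<and> (\<forall>e\<in>edges G. e \<subseteq> verts G \<and> card e = 2)"

definition independent_set :: "'a hypergraph \<Rightarrow> 'a set \<Rightarrow> bool" where
  "independent_set G I \<longleftrightarrow> I \<subseteq> verts G \<and> (\<forall>u\<in>I. \<forall>v\<in>I. {u, v} \<notin> edges G)"

definition vertex_cover :: "'a hypergraph \<Rightarrow> 'a set \<Rightarrow> bool" where
  "vertex_cover G S \<longleftrightarrow> S \<subseteq> verts G \<and> independent_set G (verts G - S)"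

definition H_VC :: "'a hypergraph \<Rightarrow> 'a hypergraph" where
  "H_VC G = (verts G, {S. vertex_cover G S})"

definition fractional_matching :: "'a hypergraph \<Rightarrow> ('a set \<Rightarrow> real) \<Rightarrow> bool" where
  "fractional_matching H y \<longleftrightarrow>
     (\<forall>S\<in>edges H. 0 \<le> y S) \<and>
     (\<forall>v\<in>verts H. (\<Sum>S\<in>{S\<in>edges H. v \<in> S}. y S) \<le> 1)"

text \<open>For a finite hypergraph without an empty edge the feasible values below are bounded, so
  that the supremum is the optimal value of the linear program. With an empty edge the program
  is unbounded and the real supremum carries no meaning; for \<open>H_VC G\<close> this happens
  only if \<open>G\<close> has no edges.\<close>

definition fractional_matching_number :: "'a hypergraph \<Rightarrow> real" where
  "fractional_matching_number H =
     Sup {(\<Sum>S\<in>edges H. y S) | y. fractional_matching H y}"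

definition kappa_f :: "'a hypergraph \<Rightarrow> real" where
  "kappa_f G = fractional_matching_number (H_VC G)"

text \<open>The linear programming definition of the fractional chromatic number: the least weight of
  a fractional cover of the vertices by independent sets. For a finite simple graph it is
  feasible (singletons) and bounded below by 0, so the infimum is its optimal value.\<close>

definition fractional_coloring :: "'a hypergraph \<Rightarrow> ('a set \<Rightarrow> real) \<Rightarrow> bool" where
  "fractional_coloring G w \<longleftrightarrow>
     (\<forall>I\<in>{I. independent_set G I}. 0 \<le> w I) \<and>
     (\<forall>v\<in>verts G. (\<Sum>I\<in>{I. independent_set G I \<and> v \<in> I}. w I) \<ge> 1)"

definition chi_f :: "'a hypergraph \<Rightarrow> real" where
  "chi_f G = Inf {(\<Sum>I\<in>{I. independent_set G I}. w I) | w. fractional_coloring G w}"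

end

theory Submission
  imports Defs
begin

text \<open>Complementation \<open>S \<mapsto> V - S\<close> matches vertex covers with independent sets. If \<open>y\<close> is a
  fractional matching of value \<open>K > 1\<close>, the covers avoiding a vertex carry weight at least
  \<open>K - 1\<close>, so the complementary weight divided by \<open>K - 1\<close> is a fractional coloring of value
  \<open>K / (K - 1)\<close>. In the same way a fractional coloring of value \<open>X > 1\<close> gives a fractional
  matching of value \<open>X / (X - 1)\<close>. An edge forces \<open>X \<ge> 2\<close>, so the decreasing
  involution \<open>t \<mapsto> t / (t - 1)\<close> exchanges the two optimal values.\<close>

definition matching_values :: "'a hypergraph \<Rightarrow> real set" where
  "matching_values H = {(\<Sum>S\<in>edges H. y S) | y. fractional_matching H y}"

definition coloring_values :: "'a hypergraph \<Rightarrow> real set" where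
  "coloring_values G = {(\<Sum>I\<in>{I. independent_set G I}. w I) | w. fractional_coloring G w}"

lemma kappa_f_eq_Sup: "kappa_f G = Sup (matching_values (H_VC G))"
  by (simp add: kappa_f_def fractional_matching_number_def matching_values_def)

lemma chi_f_eq_Inf: "chi_f G = Inf (coloring_values G)"
  by (simp add: chi_f_def coloring_values_def)

lemma finite_independent_sets: "finite (verts G) \<Longrightarrow> finite {I. independent_set G I}"
  by (rule finite_subset[of _ "Pow (verts G)"]) (auto simp: independent_set_def)

text \<open>Complementation is a bijection from vertex covers to independent sets. The predicate
  \<open>P\<close> serves both the objective (\<open>P\<close> always true) and the constraint at a
  vertex \<open>v\<close> (\<open>P S\<close> being \<open>v \<in> S\<close>).\<close>

lemma sum_vertex_covers:
  fixes y :: "'a set \<Rightarrow> 'b :: comm_monoid_add"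
  shows "(\<Sum>S\<in>{S. vertex_cover G S \<and> P S}. y S) =
    (\<Sum>I\<in>{I. independent_set G I \<and> P (verts G - I)}. y (verts G - I))"
  by (rule sum.reindex_bij_witness[where i = "\<lambda>I. verts G - I" and j = "\<lambda>S. verts G - S"])
    (auto simp: vertex_cover_def independent_set_def double_diff)

lemma sum_independent_sets_split:
  fixes w :: "'a set \<Rightarrow> real"
  assumes "finite (verts G)"
  shows "(\<Sum>I\<in>{I. independent_set G I}. w I) =
    (\<Sum>I\<in>{I. independent_set G I \<and> v \<in> I}. w I) +
    (\<Sum>I\<in>{I. independent_set G I \<and> v \<notin> I}. w I)"
proof -
  have "{I. independent_set G I} =
      {I. independent_set G I \<and> v \<in> I} \<union> {I. independent_set G I \<and> v \<notin> I}"
    by auto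
  moreover have "finite {I. independent_set G I}"
    using assms by (rule finite_independent_sets)
  ultimately show ?thesis
    by (smt (verit) Collect_mono_iff disjoint_iff finite_subset mem_Collect_eq sum.union_disjoint)
qed

lemma sum_matching:
  "(\<Sum>S\<in>edges (H_VC G). y S) = (\<Sum>I\<in>{I. independent_set G I}. y (verts G - I))"
  using sum_vertex_covers[of y G "\<lambda>_. True"] by (simp add: H_VC_def)

text \<open>A cover contains \<open>v\<close> exactly when its complement avoids \<open>v\<close>,
  so the matching program can be stated over independent sets, as the coloring program is.\<close>

lemma fractional_matching_H_VC_iff:
  "fractional_matching (H_VC G) y \<longleftrightarrow>
    (\<forall>I. independent_set G I \<longrightarrow> 0 \<le> y (verts G - I)) \<and>
    (\<forall>v\<in>verts G. (\<Sum>I\<in>{I. independent_set G I \<and> v \<notin> I}. y (verts G - I)) \<le> 1)"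
proof -
  have "(\<forall>S\<in>edges (H_VC G). 0 \<le> y S) \<longleftrightarrow>
      (\<forall>I. independent_set G I \<longrightarrow> 0 \<le> y (verts G - I))"
    by (auto simp: H_VC_def vertex_cover_def)
      (metis Diff_subset double_diff equalityD1 independent_set_def)+
  moreover have "(\<Sum>S\<in>{S\<in>edges (H_VC G). v \<in> S}. y S) =
      (\<Sum>I\<in>{I. independent_set G I \<and> v \<notin> I}. y (verts G - I))" if "v \<in> verts G" for v
    using sum_vertex_covers[of y G "\<lambda>S. v \<in> S"] that by (simp add: H_VC_def)
  moreover have "verts (H_VC G) = verts G"
    by (simp add: H_VC_def)
  ultimately show ?thesis
    by (simp add: fractional_matching_def)
qed

lemma coloring_value_of_matching_value:
  assumes "finite (verts G)" and "K \<in> matching_values (H_VC G)" and "1 < K"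
  shows "K / (K - 1) \<in> coloring_values G"
proof -
  obtain y where y: "fractional_matching (H_VC G) y"
    and K: "K = (\<Sum>I\<in>{I. independent_set G I}. y (verts G - I))"
    using assms(2) by (auto simp: matching_values_def sum_matching)
  define w where "w = (\<lambda>I. y (verts G - I) / (K - 1))"
  have "1 \<le> (\<Sum>I\<in>{I. independent_set G I \<and> v \<in> I}. w I)" if "v \<in> verts G" for v
  proof -
    have "(\<Sum>I\<in>{I. independent_set G I \<and> v \<notin> I}. y (verts G - I)) \<le> 1"
      using y that by (simp add: fractional_matching_H_VC_iff)
    then have "K - 1 \<le> (\<Sum>I\<in>{I. independent_set G I \<and> v \<in> I}. y (verts G - I))"
      using K sum_independent_sets_split[OF assms(1), of "\<lambda>I. y (verts G - I)" v] by linarith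
    then show ?thesis
      using \<open>1 < K\<close> by (simp add: w_def flip: sum_divide_distrib)
  qed
  moreover have "0 \<le> w I" if "independent_set G I" for I
    using y that \<open>1 < K\<close> by (simp add: w_def fractional_matching_H_VC_iff)
  ultimately have "fractional_coloring G w"
    by (simp add: fractional_coloring_def)
  moreover have "(\<Sum>I\<in>{I. independent_set G I}. w I) = K / (K - 1)"
    by (simp add: w_def K flip: sum_divide_distrib)
  ultimately show ?thesis
    unfolding coloring_values_def by force
qed

lemma matching_value_of_coloring_value:
  assumes "finite (verts G)" and "X \<in> coloring_values G" and "1 < X"
  shows "X / (X - 1) \<in> matching_values (H_VC G)"
proof -
  obtain w where w: "fractional_coloring G w" and X: "X = (\<Sum>I\<in>{I. independent_set G I}. w I)"
    using assms(2) by (auto simp: coloring_values_def)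
  define y where "y = (\<lambda>S. w (verts G - S) / (X - 1))"
  \<comment> \<open>Complementing twice returns \<open>I\<close> because an independent set lies
    inside \<open>verts G\<close>.\<close>
  have y_compl: "y (verts G - I) = w I / (X - 1)" if "independent_set G I" for I
    using that by (simp add: y_def independent_set_def double_diff)
  have "(\<Sum>I\<in>{I. independent_set G I \<and> v \<notin> I}. y (verts G - I)) \<le> 1" if "v \<in> verts G" for v
  proof -
    \<comment> \<open>Of the total \<open>X\<close>, at least 1 sits on sets through
      \<open>v\<close>; the rest bounds the covers containing \<open>v\<close>.\<close>
    have "1 \<le> (\<Sum>I\<in>{I. independent_set G I \<and> v \<in> I}. w I)"
      using w that by (simp add: fractional_coloring_def)
    then have "(\<Sum>I\<in>{I. independent_set G I \<and> v \<notin> I}. w I) \<le> X - 1"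
      using X sum_independent_sets_split[OF assms(1), of w v] by linarith
    then show ?thesis
      using \<open>1 < X\<close> by (simp add: y_compl flip: sum_divide_distrib)
  qed
  moreover have "0 \<le> y (verts G - I)" if "independent_set G I" for I
    using w that \<open>1 < X\<close> by (simp add: y_compl fractional_coloring_def)
  ultimately have "fractional_matching (H_VC G) y"
    by (simp add: fractional_matching_H_VC_iff)
  moreover have "(\<Sum>S\<in>edges (H_VC G). y S) = X / (X - 1)"
    by (simp add: sum_matching y_compl X flip: sum_divide_distrib)
  ultimately show ?thesis
    unfolding matching_values_def by force
qed

text \<open>No independent set contains both ends of an edge, so the weights of at least 1 required
  at \<open>u\<close> and at \<open>v\<close> sit on disjoint families.\<close>

lemma coloring_value_ge_2:
  assumes "finite (verts G)" and "{u, v} \<in> edges G" and "u \<in> verts G" "v \<in> verts G"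
    and "X \<in> coloring_values G"
  shows "2 \<le> X"
proof -
  obtain w where w: "fractional_coloring G w" and X: "X = (\<Sum>I\<in>{I. independent_set G I}. w I)"
    using assms(5) by (auto simp: coloring_values_def)
  have "(\<Sum>I\<in>{I. independent_set G I \<and> v \<in> I}. w I) \<le>
      (\<Sum>I\<in>{I. independent_set G I \<and> u \<notin> I}. w I)"
  proof (rule sum_mono2)
    show "finite {I. independent_set G I \<and> u \<notin> I}"
      using finite_independent_sets[OF assms(1)] by simp
    show "{I. independent_set G I \<and> v \<in> I} \<subseteq> {I. independent_set G I \<and> u \<notin> I}"
      using assms(2) by (auto simp: independent_set_def)
    show "0 \<le> w I" if "I \<in> {I. independent_set G I \<and> u \<notin> I} - {I. independent_set G I \<and> v \<in> I}" for I
      using w that by (simp add: fractional_coloring_def)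
  qed
  moreover have "1 \<le> (\<Sum>I\<in>{I. independent_set G I \<and> u \<in> I}. w I)"
    and "1 \<le> (\<Sum>I\<in>{I. independent_set G I \<and> v \<in> I}. w I)"
    using w assms(3,4) by (simp_all add: fractional_coloring_def)
  ultimately show ?thesis
    using X sum_independent_sets_split[OF assms(1), of w u] by linarith
qed

text \<open>Weight 1 everywhere is feasible: \<open>{v}\<close> is independent since edges have two
  elements, which excludes loops.\<close>

lemma coloring_values_nonempty:
  assumes "finite_simple_graph G"
  shows "coloring_values G \<noteq> {}"
proof -
  have "1 \<le> (\<Sum>I\<in>{I. independent_set G I \<and> v \<in> I}. 1::real)" if "v \<in> verts G" for v
  proof -
    have "independent_set G {v}"
      using assms that by (auto simp: independent_set_def finite_simple_graph_def)
    \<comment> \<open>Finiteness matters here: \<open>card\<close> of an infinite set is 0.\<close>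
    moreover have "finite {I. independent_set G I \<and> v \<in> I}"
      using finite_independent_sets[of G] assms by (simp add: finite_simple_graph_def)
    ultimately have "card {I. independent_set G I \<and> v \<in> I} \<noteq> 0"
      by auto
    then show ?thesis
      by simp
  qed
  then have "fractional_coloring G (\<lambda>_. 1)"
    by (simp add: fractional_coloring_def)
  then show ?thesis
    by (auto simp: coloring_values_def)
qed

text \<open>With \<open>S = Sup A\<close> and \<open>T = Inf B\<close>, both above 1, the claim is
  equivalent to \<open>(S - 1) * (T - 1) = 1\<close>. Each transfer hypothesis yields one
  inequality.\<close>

lemma inverse_Sup_plus_inverse_Inf_eq_1:
  fixes A B :: "real set"
  assumes "B \<noteq> {}" and B_ge: "\<And>x. x \<in> B \<Longrightarrow> 2 \<le> x"
    and BA: "\<And>x. x \<in> B \<Longrightarrow> x / (x - 1) \<in> A"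
    and AB: "\<And>k. k \<in> A \<Longrightarrow> 1 < k \<Longrightarrow> k / (k - 1) \<in> B"
  shows "1 / Sup A + 1 / Inf B = 1"
proof -
  obtain x0 where x0: "x0 \<in> B"
    using assms(1) by blast
  have bddB: "bdd_below B"
    using B_ge by (rule bdd_belowI)
  have Inf_ge: "2 \<le> Inf B"
    using assms(1) B_ge by (rule cInf_greatest)
  have le: "k \<le> Inf B / (Inf B - 1)" if "k \<in> A" for k
  proof (cases "1 < k")
    case True
    then have "Inf B \<le> k / (k - 1)"
      using AB[OF that] bddB by (intro cInf_lower)
    then show ?thesis
      using True Inf_ge by (simp add: field_simps)
  \<comment> \<open>Small values such as 0 from the zero matching cannot be transferred, but they
    lie below the bound anyway.\<close>
  next
    case False
    moreover have "1 \<le> Inf B / (Inf B - 1)"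
      using Inf_ge by (simp add: field_simps)
    ultimately show ?thesis
      by linarith
  qed
  then have bddA: "bdd_above A"
    by (rule bdd_aboveI)
  have Sup_ge: "x / (x - 1) \<le> Sup A" if "x \<in> B" for x
    using BA[OF that] bddA by (rule cSup_upper)
  \<comment> \<open>One transferred value above 1 makes \<open>Sup A - 1\<close> positive, which
    permits the division below.\<close>
  moreover have "1 < x0 / (x0 - 1)"
    using B_ge[OF x0] by (simp add: field_simps)
  ultimately have Sup_gt: "1 < Sup A"
    using x0 by fastforce
  have "Sup A \<le> Inf B / (Inf B - 1)"
    using BA[OF x0] le by (intro cSup_least) auto
  moreover have "Sup A / (Sup A - 1) \<le> Inf B"
  proof (rule cInf_greatest[OF assms(1)])
    fix x assume "x \<in> B"
    \<comment> \<open>The relation \<open>x / (x - 1) \<le> s\<close> is symmetric in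
      \<open>x\<close> and \<open>s\<close> when both exceed 1.\<close>
    then show "Sup A / (Sup A - 1) \<le> x"
      using Sup_ge[of x] B_ge[of x] Sup_gt by (simp add: field_simps)
  qed
  ultimately show ?thesis
    using Sup_gt Inf_ge by (simp add: field_simps)
qed

theorem theorem5:
  fixes G :: "'a hypergraph"
  assumes "finite_simple_graph G" and "edges G \<noteq> {}"
  shows "1 / kappa_f G + 1 / chi_f G = 1"
proof -
  have fin: "finite (verts G)"
    using assms(1) by (simp add: finite_simple_graph_def)
  obtain u v where uv: "{u, v} \<in> edges G" "u \<in> verts G" "v \<in> verts G"
    using assms unfolding finite_simple_graph_def
    by (metis card_2_iff all_not_in_conv insert_subset)
  have ge2: "2 \<le> X" if "X \<in> coloring_values G" for X
    using fin uv that by (rule coloring_value_ge_2)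
  show ?thesis
    unfolding kappa_f_eq_Sup chi_f_eq_Inf
  proof (rule inverse_Sup_plus_inverse_Inf_eq_1)
    show "coloring_values G \<noteq> {}"
      using assms(1) by (rule coloring_values_nonempty)
    show "X / (X - 1) \<in> matching_values (H_VC G)" if "X \<in> coloring_values G" for X
      using matching_value_of_coloring_value[OF fin that] ge2[OF that] by simp
  qed (use ge2 coloring_value_of_matching_value[OF fin] in auto)
qed

end
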